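(* For every real $c>0$ and every positive integer $d$, there exists a finite connected graph $G$ without isolated vertices, of diameter at least $d$, such that $$\gamma_{\mathrm{pr}}(G\times G) < c\,\gamma_{\mathrm{pr}}(G)^2.$$
   Context: All graphs are finite, simple and undirected. The direct product $G\times H$ has vertex set $V(G)\times V(H)$, with $(u_G,u_H)$ adjacent to $(v_G,v_H)$ iff $u_Gv_G\in E(G)$ and $u_Hv_H\in E(H)$. A set $D\subseteq V(G)$ is dominating if every vertex of $G$ is in $D$ or adjacent to a vertex of $D$. For a graph without isolated vertices, the paired domination number $\gamma_{\mathrm{pr}}(G)$ is the minimum size of a dominating set $D$ such that the induced subgraph $G[D]$ has a perfect matching. *)

theory Defs
  imports Complex_Main "Graph_Theory.Graph_Theory"
begin

text \<open>
  A finite simple undirected graph is a \<^locale>\<open>pair_graph\<close>: each undirected edge is represented by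
  its two opposite arcs.
\<close>

definition direct_product ::
    "'a pair_pre_digraph \<Rightarrow> 'b pair_pre_digraph \<Rightarrow> ('a \<times> 'b) pair_pre_digraph" where
  "direct_product G H =
     \<lparr> pverts = pverts G \<times> pverts H,
       parcs = {((u, x), (v, y)) | u x v y. (u, v) \<in> parcs G \<and> (x, y) \<in> parcs H} \<rparr>"

definition no_isolated_verts :: "('a, 'b) pre_digraph \<Rightarrow> bool" where
  "no_isolated_verts G \<longleftrightarrow> (\<forall>v \<in> verts G. \<exists>u \<in> verts G. (v, u) \<in> arcs_ends G)"

text \<open>
  The distance \<open>\<mu>\<close> with unit arc costs is the least number of arcs on a walk, and is infinite if
  there is no walk.
\<close>

definition diameter :: "('a, 'b) pre_digraph \<Rightarrow> ereal" where
  "diameter G = (SUP u \<in> verts G. SUP v \<in> verts G. wf_digraph.\<mu> G (\<lambda>_. 1) u v)"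

definition dominating_set :: "('a, 'b) pre_digraph \<Rightarrow> 'a set \<Rightarrow> bool" where
  "dominating_set G D \<longleftrightarrow>
     D \<subseteq> verts G \<and> (\<forall>v \<in> verts G. v \<in> D \<or> (\<exists>u \<in> D. (v, u) \<in> arcs_ends G))"

definition perfect_matching :: "('a, 'b) pre_digraph \<Rightarrow> 'a set set \<Rightarrow> bool" where
  "perfect_matching G M \<longleftrightarrow>
     M \<subseteq> {{u, v} | u v. (u, v) \<in> arcs_ends G} \<and> (\<forall>v \<in> verts G. \<exists>!e. e \<in> M \<and> v \<in> e)"

definition paired_dominating_set :: "('a, 'b) pre_digraph \<Rightarrow> 'a set \<Rightarrow> bool" where
  "paired_dominating_set G D \<longleftrightarrow> dominating_set G D \<and> (\<exists>M. perfect_matching (G \<restriction> D) M)"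

text \<open>Only meaningful if \<open>G\<close> has a paired dominating set, as every finite graph without isolated
  vertices does.\<close>

definition paired_domination_number :: "('a, 'b) pre_digraph \<Rightarrow> nat" where
  "paired_domination_number G = (LEAST k. \<exists>D. paired_dominating_set G D \<and> card D = k)"

lemma pair_graph_direct_product:
  assumes "pair_graph G" and "pair_graph H"
  shows "pair_graph (direct_product G H)"
proof -
  interpret G: pair_graph G by fact
  interpret H: pair_graph H by fact
  have "parcs (direct_product G H) \<subseteq> (pverts G \<times> pverts H) \<times> (pverts G \<times> pverts H)"
    by (auto simp: direct_product_def dest: G.in_arcsD1 G.in_arcsD2 H.in_arcsD1 H.in_arcsD2)
  then have fin: "finite (parcs (direct_product G H))"
    by (rule finite_subset) (simp add: G.pair_finite_verts H.pair_finite_verts)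
  have "sym (parcs G)" "sym (parcs H)"
    using G.pair_sym_arcs H.pair_sym_arcs by (simp_all add: symmetric_def)
  then have sym: "sym (parcs (direct_product G H))"
    unfolding direct_product_def sym_def by auto
  show ?thesis
    using fin sym
    by unfold_locales
      (auto simp: direct_product_def symmetric_def G.pair_finite_verts H.pair_finite_verts
        dest: G.in_arcsD1 G.in_arcsD2 H.in_arcsD1 H.in_arcsD2 G.pair_no_loops)
qed

lemma no_isolated_verts_direct_product:
  fixes G :: "'a pair_pre_digraph" and H :: "'b pair_pre_digraph"
  assumes "no_isolated_verts G" and "no_isolated_verts H"
  shows "no_isolated_verts (direct_product G H)"
  using assms by (fastforce simp: no_isolated_verts_def direct_product_def)

end

theory Submission
  imports Defs "HOL-Library.Nat_Bijection" "HOL-Library.Disjoint_Sets"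
begin

text \<open>
  Let \<open>G\<close> be the incidence graph between \<open>2 * k\<close> points and all \<open>k\<close>-subsets of them (the blocks), with
  a path of length about \<open>d\<close> attached to one point to make the diameter large. A paired dominating set
  contains a neighbour of every vertex; hence its points meet every block, and there are more than
  \<open>k\<close> of them. In \<open>G \<times> G\<close>, however, linearly many vertices dominate: the points have a total
  dominating set whose size depends on \<open>d\<close> only, and by a counting argument some \<open>10 * k\<close> pairs of
  points meet every product of two blocks. Passing from a dominating to a paired dominating set costs
  only a factor 2, so the ratio in question is \<open>O(1 / k)\<close> for fixed \<open>d\<close>.
\<close>

section \<open>Maximal matchings and paired dominating sets\<close>

text \<open>A nonempty member of \<open>E\<close> that misses \<open>\<Union>M\<close> could be
  added to an inclusion-maximal \<open>M\<close>. For a set of edges this yields a maximal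
  matching.\<close>

lemma exists_maximal_disjoint_subfamily:
  assumes "finite E"
  shows "\<exists>M\<subseteq>E. disjoint M \<and> (\<forall>e\<in>E. e \<noteq> {} \<longrightarrow> e \<inter> \<Union>M \<noteq> {})"
proof -
  define F where "F = {M. M \<subseteq> E \<and> disjoint M}"
  have "finite F" using assms by (simp add: F_def)
  moreover have "F \<noteq> {}" by (auto simp: F_def intro: exI[of _ "{}"])
  ultimately obtain M where MF: "M \<in> F" and max: "\<forall>M'\<in>F. M \<subseteq> M' \<longrightarrow> M = M'"
    using finite_has_maximal by metis
  then have M: "M \<subseteq> E" "disjoint M" by (simp_all add: F_def)
  have "e \<inter> \<Union>M \<noteq> {}" if e: "e \<in> E" "e \<noteq> {}" for e
  proof
    assume dis: "e \<inter> \<Union>M = {}"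
    have "insert e M \<in> F"
      using M e dis by (auto simp: F_def disjoint_def)
    then have "e \<in> M" using max by blast
    then show False using dis e by blast
  qed
  with M show ?thesis by blast
qed

lemma perfect_matching_of_disjoint_edges:
  assumes "disjoint M" and "M \<subseteq> {{u, v} | u v. (u, v) \<in> arcs_ends G}"
  shows "perfect_matching (G \<restriction> \<Union>M) M"
proof -
  have "e \<in> {{u, v} | u v. (u, v) \<in> arcs_ends (G \<restriction> \<Union>M)}" if e: "e \<in> M" for e
  proof -
    obtain u v where uv: "e = {u, v}" "(u, v) \<in> arcs_ends G" using assms(2) e by blast
    then have "u \<in> \<Union>M" "v \<in> \<Union>M" using e by auto
    then have "(u, v) \<in> arcs_ends (G \<restriction> \<Union>M)" using uv by (auto simp: arcs_ends_conv)
    then show ?thesis using uv by blast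
  qed
  moreover have "\<exists>!e. e \<in> M \<and> v \<in> e" if "v \<in> \<Union>M" for v
    using that assms(1) by (auto simp: disjoint_def)
  ultimately show ?thesis unfolding perfect_matching_def by (simp add: subset_iff)
qed

text \<open>A maximal matching among the edges that meet a dominating set has at most as many edges as the
  set has elements, and its vertex set dominates.\<close>

lemma exists_paired_dominating_set_card_le:
  assumes fin: "finite (verts G)" and wf: "wf_digraph G" and iso: "no_isolated_verts G"
    and D: "dominating_set G D"
  shows "\<exists>W. paired_dominating_set G W \<and> card W \<le> 2 * card D"
proof -
  interpret wf_digraph G by fact
  define E where "E = {{u, v} | u v. (u, v) \<in> arcs_ends G \<and> {u, v} \<inter> D \<noteq> {}}"
  have E_edge: "\<exists>u v. e = {u, v} \<and> (u, v) \<in> arcs_ends G" if "e \<in> E" for e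
    using that unfolding E_def by blast
  have E_verts: "e \<subseteq> verts G" if "e \<in> E" for e
    using E_edge[OF that] adj_in_verts by auto
  have finE: "finite E"
    using E_verts fin by (intro finite_subset[of E "Pow (verts G)"]) auto
  obtain M where M: "M \<subseteq> E" "disjoint M"
    and max: "\<forall>e\<in>E. e \<noteq> {} \<longrightarrow> e \<inter> \<Union>M \<noteq> {}"
    using exists_maximal_disjoint_subfamily[OF finE] by metis
  have finD: "finite D" using D fin finite_subset unfolding dominating_set_def by blast
  \<comment> \<open>By maximality of \<open>M\<close>, no edge that meets \<open>D\<close> avoids
    all matched vertices.\<close>
  have meets: "v \<in> \<Union>M \<or> u \<in> \<Union>M" if "(v, u) \<in> arcs_ends G" "v \<in> D \<or> u \<in> D" for u v
  proof -
    have "{v, u} \<in> E" using that unfolding E_def by blast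
    from bspec[OF max this] show ?thesis by auto
  qed
  have WV: "\<Union>M \<subseteq> verts G" using M(1) E_verts by blast
  have "v \<in> \<Union>M \<or> (\<exists>u\<in>\<Union>M. (v, u) \<in> arcs_ends G)" if v: "v \<in> verts G" for v
  proof -
    \<comment> \<open>If \<open>v\<close> is in \<open>D\<close>, any neighbour will do, and one
      exists since no vertex is isolated; otherwise take a neighbour in \<open>D\<close>.\<close>
    obtain u where "(v, u) \<in> arcs_ends G" "v \<in> D \<or> u \<in> D"
      using v D iso unfolding dominating_set_def no_isolated_verts_def by blast
    then show ?thesis using meets by blast
  qed
  then have dom: "dominating_set G (\<Union>M)" using WV unfolding dominating_set_def by blast
  have pm: "perfect_matching (G \<restriction> \<Union>M) M"
    using M E_edge by (intro perfect_matching_of_disjoint_edges) auto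
  have "\<exists>x. x \<in> e \<inter> D" if "e \<in> E" for e using that unfolding E_def by auto
  then have "\<forall>e\<in>M. \<exists>x. x \<in> e \<inter> D" using M(1) by auto
  \<comment> \<open>Disjoint edges select distinct elements of \<open>D\<close>, so \<open>M\<close>
    has at most \<open>card D\<close> edges.\<close>
  then obtain f where f: "\<And>e. e \<in> M \<Longrightarrow> f e \<in> e \<inter> D" by metis
  have "inj_on f M"
    using f M(2) by (intro inj_onI) (metis IntD1 IntI disjointD emptyE)
  then have "card M \<le> card D"
    using f finD by (intro card_inj_on_le[of f]) auto
  moreover have "card (\<Union>M) \<le> 2 * card M"
  proof -
    have "card e \<le> 2" if "e \<in> M" for e
    proof -
      obtain u v where "e = {u, v}" using M(1) E_edge \<open>e \<in> M\<close> by blast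
      then show ?thesis by (simp add: card_insert_if)
    qed
    then have "sum card M \<le> 2 * card M"
      using sum_bounded_above[of M card 2] by (simp add: mult.commute)
    then show ?thesis using card_Union_le_sum_card[of M] by linarith
  qed
  ultimately show ?thesis using dom pm unfolding paired_dominating_set_def by fastforce
qed

lemma paired_domination_number_le:
  assumes "finite (verts G)" "wf_digraph G" "no_isolated_verts G" "dominating_set G D"
  shows "paired_domination_number G \<le> 2 * card D"
proof -
  obtain W where "paired_dominating_set G W" "card W \<le> 2 * card D"
    using exists_paired_dominating_set_card_le[OF assms] by blast
  then show ?thesis
    unfolding paired_domination_number_def
    by (metis (mono_tags, lifting) Least_le le_trans)
qed

text \<open>The \<open>LEAST\<close> is attained only if some paired dominating set exists; one
  arises from the whole vertex set, which dominates trivially.\<close>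

lemma paired_domination_number_geI:
  assumes "finite (verts G)" "wf_digraph G" "no_isolated_verts G"
    and "\<And>D. paired_dominating_set G D \<Longrightarrow> n \<le> card D"
  shows "n \<le> paired_domination_number G"
proof -
  have "dominating_set G (verts G)" unfolding dominating_set_def by blast
  then have "\<exists>k D. paired_dominating_set G D \<and> card D = k"
    using exists_paired_dominating_set_card_le[OF assms(1-3)] by blast
  from LeastI_ex[OF this] obtain D where
    "paired_dominating_set G D" "card D = paired_domination_number G"
    unfolding paired_domination_number_def by (elim exE conjE)
  then show ?thesis using assms(4)[of D] by simp
qed

text \<open>A vertex inside \<open>D\<close> is served by its matching partner: a paired dominating
  set is a total dominating set.\<close>

lemma paired_dominating_set_neighbour:
  assumes D: "paired_dominating_set G D" and sym: "symmetric G" and v: "v \<in> verts G"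
  shows "\<exists>u\<in>D. (v, u) \<in> arcs_ends G"
proof (cases "v \<in> D")
  case False
  then show ?thesis
    using D v unfolding paired_dominating_set_def dominating_set_def by blast
next
  case True
  obtain M where M: "perfect_matching (G \<restriction> D) M"
    using D unfolding paired_dominating_set_def by blast
  then obtain e where "e \<in> M" "v \<in> e"
    using True unfolding perfect_matching_def by auto
  then obtain x y where "v \<in> {x, y}" and xy: "(x, y) \<in> arcs_ends (G \<restriction> D)"
    using M unfolding perfect_matching_def by blast
  moreover from xy have "x \<in> D" "y \<in> D" "(x, y) \<in> arcs_ends G"
    by (auto simp: arcs_ends_conv)
  moreover from this have "(y, x) \<in> arcs_ends G"
    using sym unfolding symmetric_def by (blast dest: symD)
  ultimately show ?thesis by blast
qed

section \<open>A lower bound on the diameter\<close>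

text \<open>The potential drops by at most 1 along each arc, so every walk from \<open>u\<close> to
  \<open>v\<close> has at least \<open>h u - h v\<close> arcs.\<close>

lemma diameter_ge_potential_difference:
  fixes h :: "'a \<Rightarrow> real"
  assumes wf: "wf_digraph G" and u: "u \<in> verts G" and v: "v \<in> verts G"
    and h: "\<And>x y. (x, y) \<in> arcs_ends G \<Longrightarrow> h x \<le> h y + 1"
  shows "ereal (h u - h v) \<le> diameter G"
proof -
  interpret wf_digraph G by fact
  have "h u \<le> h v + awalk_cost (\<lambda>_. 1) p" if "awalk u p v" for p
    using that
  proof (induction p arbitrary: u)
    case (Cons e es)
    then have "(u, head G e) \<in> arcs_ends G" and "awalk (head G e) es v"
      by (auto simp: awalk_Cons_iff in_arcs_imp_in_arcs_ends)
    with h[of u "head G e"] Cons.IH[of "head G e"] show ?case by simp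
  qed (simp add: awalk_Nil_iff)
  \<comment> \<open>The infimum over walks also covers the case that there is no walk, where it is
    infinite.\<close>
  then have "ereal (h u - h v) \<le> \<mu> (\<lambda>_. 1) u v"
    unfolding \<mu>_def by (intro INF_greatest) force
  also have "\<dots> \<le> diameter G"
    unfolding diameter_def using u v by (meson SUP_upper SUP_upper2)
  finally show ?thesis .
qed

section \<open>Half-sets and their transversals\<close>

definition half_sets :: "nat \<Rightarrow> nat set set" where
  "half_sets k = {A. A \<subseteq> {..<2 * k} \<and> card A = k}"

lemma finite_half_sets: "finite (half_sets k)"
  unfolding half_sets_def by simp

lemma finite_half_set: "A \<in> half_sets k \<Longrightarrow> finite A"
  unfolding half_sets_def using finite_subset by blast

lemma card_half_sets_le: "card (half_sets k) \<le> 4 ^ k"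
proof -
  have "card (half_sets k) \<le> card (Pow {..<2 * k})"
    unfolding half_sets_def by (intro card_mono) auto
  then show ?thesis by (simp add: card_Pow power_mult)
qed

text \<open>A set of at most \<open>k\<close> elements leaves at least \<open>k\<close> of the
  \<open>2 * k\<close> numbers uncovered, hence misses a whole half-set.\<close>

lemma transversal_of_half_sets_card:
  assumes "finite I" and "\<And>A. A \<in> half_sets k \<Longrightarrow> A \<inter> I \<noteq> {}"
  shows "k < card I"
proof (rule ccontr)
  assume "\<not> k < card I"
  moreover have "card ({..<2 * k} - I) \<ge> 2 * k - card I"
    using diff_card_le_card_Diff[OF assms(1), of "{..<2 * k}"] by simp
  ultimately have "k \<le> card ({..<2 * k} - I)" by linarith
  then obtain A where "A \<subseteq> {..<2 * k} - I" "card A = k" by (metis obtain_subset_with_card_n)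
  then show False using assms(2)[of A] unfolding half_sets_def by blast
qed

lemma exists_half_set_containing:
  assumes "i < 2 * k" "j < 2 * k" "2 \<le> k"
  shows "\<exists>A\<in>half_sets k. i \<in> A \<and> j \<in> A"
proof -
  have "card {i, j} \<le> k" using assms(3) by (simp add: card_insert_if)
  then obtain A where "{i, j} \<subseteq> A" "A \<subseteq> {..<2 * k}" "card A = k"
    using exists_subset_between[of "{i, j}" k "{..<2 * k}"] assms by auto
  then show ?thesis unfolding half_sets_def by blast
qed

text \<open>A given product of two half-sets contains a quarter of all pairs, so a sequence of \<open>10 * k\<close>
  pairs misses it for a \<open>(3/4) ^ (10 * k) < 16 ^ - k\<close> fraction of all sequences, while there are at
  most \<open>16 ^ k\<close> such products.\<close>

lemma exists_small_transversal_of_half_set_products: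
  assumes k: "k > 0"
  shows "\<exists>E \<subseteq> {..<2 * k} \<times> {..<2 * k}. card E \<le> 10 * k \<and>
    (\<forall>A\<in>half_sets k. \<forall>B\<in>half_sets k. E \<inter> A \<times> B \<noteq> {})"
proof -
  let ?P = "{..<2 * k} \<times> {..<2 * k}"
  \<comment> \<open>Sequences may repeat entries, which makes every count a pure power; the set of
    entries becomes the transversal.\<close>
  let ?seqs = "\<lambda>Q. {xs. set xs \<subseteq> Q \<and> length xs = 10 * k}"
  let ?HH = "half_sets k \<times> half_sets k"
  let ?bad = "\<Union>p\<in>?HH. ?seqs (?P - fst p \<times> snd p)"
  have finP: "finite ?P" and cardP: "card ?P = 4 * k * k"
    by (simp_all add: card_cartesian_product)
  have card_miss: "card (?seqs (?P - fst p \<times> snd p)) = (3 * k * k) ^ (10 * k)" if "p \<in> ?HH" for p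
  proof -
    have "fst p \<in> half_sets k" "snd p \<in> half_sets k" using that by auto
    then have "fst p \<times> snd p \<subseteq> ?P" "card (fst p \<times> snd p) = k * k"
      and "finite (fst p \<times> snd p)"
      by (auto simp: finite_half_set) (auto simp: half_sets_def card_cartesian_product)
    then have "card (?P - fst p \<times> snd p) = 3 * k * k"
      by (simp add: card_Diff_subset card_cartesian_product)
    then show ?thesis by (simp add: card_lists_length_eq)
  qed
  have "card ?bad \<le> (\<Sum>p\<in>?HH. card (?seqs (?P - fst p \<times> snd p)))"
    by (intro card_UN_le) (simp add: finite_half_sets)
  also have "\<dots> = card ?HH * (3 * k * k) ^ (10 * k)"
    using card_miss by simp
  also have "\<dots> \<le> (4 ^ k * 4 ^ k) * (3 * k * k) ^ (10 * k)"
    using card_half_sets_le[of k] by (intro mult_right_mono) (auto simp: card_cartesian_product mult_mono)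
  also have "\<dots> = (16 * (3 * k * k) ^ 10) ^ k"
  proof -
    have "(4::nat) ^ k * 4 ^ k = 16 ^ k" by (simp flip: power_mult_distrib)
    then show ?thesis by (simp only: power_mult power_mult_distrib)
  qed
  \<comment> \<open>This is where the factor 10 comes from: \<open>16 * 3 ^ 10 < 4 ^ 10\<close>, and
    10 is the least such exponent.\<close>
  also have "\<dots> < ((4 * k * k) ^ 10) ^ k"
    using k by (intro power_strict_mono) (auto simp: power_mult_distrib)
  also have "\<dots> = card (?seqs ?P)"
    by (simp only: card_lists_length_eq[OF finP] cardP power_mult)
  finally have "card ?bad < card (?seqs ?P)" .
  moreover have "finite ?bad"
    by (auto simp: finite_half_sets intro: finite_lists_length_eq)
  ultimately obtain xs where xs: "xs \<in> ?seqs ?P" "xs \<notin> ?bad"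
    by (meson card_mono leD subsetI)
  have "set xs \<inter> A \<times> B \<noteq> {}" if "A \<in> half_sets k" "B \<in> half_sets k" for A B
  proof
    assume "set xs \<inter> A \<times> B = {}"
    then have "xs \<in> ?seqs (?P - fst (A, B) \<times> snd (A, B))" using xs(1) by auto
    then have "xs \<in> ?bad" using that by (intro UN_I[of "(A, B)"]) auto
    then show False using xs(2) by contradiction
  qed
  moreover have "card (set xs) \<le> 10 * k" using xs card_length[of xs] by simp
  ultimately show ?thesis using xs by blast
qed

section \<open>The graph, its connectedness and its diameter\<close>

text \<open>Points become even and blocks odd numbers, so that both kinds of vertices live
  disjointly in the type \<open>nat\<close>.\<close>

definition point :: "nat \<Rightarrow> nat" where
  "point i = 2 * i"

text \<open>\<open>set_encode\<close> is injective on finite sets, which suffices as half-sets are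
  finite.\<close>

definition block :: "nat set \<Rightarrow> nat" where
  "block A = 2 * set_encode A + 1"

lemma point_eq_iff [simp]: "point i = point j \<longleftrightarrow> i = j"
  by (simp add: point_def)

lemma point_neq_block [simp]: "point i \<noteq> block A" "block A \<noteq> point i"
  by (auto simp: point_def block_def) presburger+

lemma block_eq_iff [simp]: "finite A \<Longrightarrow> finite B \<Longrightarrow> block A = block B \<longleftrightarrow> A = B"
  by (auto simp: block_def set_encode_eq)

text \<open>The points \<open>i < 2 * k\<close> are the elements of the blocks; the points from \<open>2 * k - 1\<close> to
  \<open>2 * k + d\<close> form the path.\<close>

definition half_graph_edges :: "nat \<Rightarrow> nat \<Rightarrow> (nat \<times> nat) set" where
  "half_graph_edges k d =
     {(point i, block A) | i A. A \<in> half_sets k \<and> i \<in> A} \<union>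
     {(point i, point (Suc i)) | i. 2 * k \<le> Suc i \<and> i < 2 * k + d}"

definition half_graph :: "nat \<Rightarrow> nat \<Rightarrow> nat pair_pre_digraph" where
  "half_graph k d =
     \<lparr> pverts = point ` {..2 * k + d} \<union> block ` half_sets k,
       parcs = half_graph_edges k d \<union> (half_graph_edges k d)\<inverse> \<rparr>"

lemma pverts_half_graph:
  "pverts (half_graph k d) = point ` {..2 * k + d} \<union> block ` half_sets k"
  by (simp add: half_graph_def)

lemma point_block_arc:
  "A \<in> half_sets k \<Longrightarrow> i \<in> A \<Longrightarrow> (point i, block A) \<in> parcs (half_graph k d)"
  "A \<in> half_sets k \<Longrightarrow> i \<in> A \<Longrightarrow> (block A, point i) \<in> parcs (half_graph k d)"
  by (auto simp: half_graph_def half_graph_edges_def)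

lemma path_arc:
  assumes "2 * k \<le> Suc i" "i < 2 * k + d"
  shows "(point i, point (Suc i)) \<in> parcs (half_graph k d)"
    and "(point (Suc i), point i) \<in> parcs (half_graph k d)"
  using assms by (auto simp: half_graph_def half_graph_edges_def)

lemma arc_from_block:
  assumes "(block A, u) \<in> parcs (half_graph k d)" "A \<in> half_sets k"
  shows "\<exists>i\<in>A. u = point i"
  using assms by (auto simp: half_graph_def half_graph_edges_def finite_half_set)

lemma pair_graph_half_graph: "pair_graph (half_graph k d)"
proof -
  have sub: "parcs (half_graph k d) \<subseteq> pverts (half_graph k d) \<times> pverts (half_graph k d)"
    by (auto simp: half_graph_def half_graph_edges_def half_sets_def)
  have fin: "finite (pverts (half_graph k d))"
    by (simp add: pverts_half_graph finite_half_sets)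
  then have "finite (parcs (half_graph k d))" using sub finite_subset by blast
  moreover have "sym (parcs (half_graph k d))"
    by (auto simp: half_graph_def sym_def)
  moreover have "x \<noteq> y" if "(x, y) \<in> parcs (half_graph k d)" for x y
    using that by (auto simp: half_graph_def half_graph_edges_def)
  ultimately show ?thesis
    using fin sub by unfold_locales (auto simp: symmetric_def)
qed

text \<open>Every vertex reaches \<open>point 0\<close>: an element through a block shared with 0, a
  path point down the path, a block through one of its elements. For \<open>k = 1\<close> the blocks
  are singletons and \<open>point 0\<close> is cut off from the path.\<close>

lemma connected_half_graph:
  assumes k: "2 \<le> k"
  shows "Digraph_Component.connected (with_proj (half_graph k d))"
proof -
  interpret G: pair_graph "half_graph k d" by (rule pair_graph_half_graph)
  let ?G = "with_proj (half_graph k d)"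
  note trans = G.adj_reachable_trans
  have zero: "point 0 \<rightarrow>\<^sup>*\<^bsub>?G\<^esub> point 0" by (auto simp: pverts_half_graph)
  have elem: "point i \<rightarrow>\<^sup>*\<^bsub>?G\<^esub> point 0" if i: "i < 2 * k" for i
  proof -
    obtain A where "A \<in> half_sets k" "i \<in> A" "0 \<in> A"
      using exists_half_set_containing[of i k 0] i k by auto
    then show ?thesis by (meson point_block_arc trans zero)
  qed
  have points: "point i \<rightarrow>\<^sup>*\<^bsub>?G\<^esub> point 0" if "i \<le> 2 * k + d" for i
    using that
  proof (induction i)
    case 0
    show ?case by (rule zero)
  next
    case (Suc i)
    show ?case
    proof (cases "Suc i < 2 * k")
      case False
      \<comment> \<open>The lowest path arc, at \<open>Suc i = 2 * k\<close>, ends in the element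
        \<open>2 * k - 1\<close>; there the induction hypothesis already speaks of an
        element.\<close>
      then have "(point (Suc i), point i) \<in> parcs (half_graph k d)"
        using Suc.prems by (intro path_arc) auto
      then show ?thesis using Suc trans by auto
    qed (rule elem)
  qed
  have "v \<rightarrow>\<^sup>*\<^bsub>?G\<^esub> point 0" if v: "v \<in> pverts (half_graph k d)" for v
    using v unfolding pverts_half_graph
  proof
    assume "v \<in> block ` half_sets k"
    then obtain A where A: "A \<in> half_sets k" "v = block A" by blast
    then have "A \<noteq> {}" using k by (auto simp: half_sets_def)
    then obtain i where "i \<in> A" by blast
    moreover have "i < 2 * k" using A \<open>i \<in> A\<close> by (auto simp: half_sets_def)
    ultimately show ?thesis using A by (meson point_block_arc trans elem)
  qed (use points in auto)
  then have "u \<rightarrow>\<^sup>*\<^bsub>?G\<^esub> v" if "u \<in> pverts (half_graph k d)" "v \<in> pverts (half_graph k d)" for u v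
    using that symmetric_reachable[OF G.pair_sym_arcs] G.reachable_trans by blast
  then show ?thesis
    by (intro G.connectedI G.reachable_mk_symmetricI) (auto simp: pverts_half_graph)
qed

lemma diameter_half_graph: "ereal (real d) \<le> diameter (with_proj (half_graph k d))"
proof -
  interpret G: pair_graph "half_graph k d" by (rule pair_graph_half_graph)
  \<comment> \<open>The height along the path. Subtraction on \<open>nat\<close> truncates, so
    elements have height 0, as do the blocks (odd numbers).\<close>
  define h :: "nat \<Rightarrow> real" where "h v = (if even v then real (v div 2 - 2 * k) else 0)" for v
  have h_point: "h (point i) = real (i - 2 * k)" for i by (simp add: h_def point_def)
  have h_block: "h (block A) = 0" for A by (simp add: h_def block_def)
  have h_elem: "h (point i) = 0" if "A \<in> half_sets k" "i \<in> A" for i A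
    using that by (auto simp: h_point half_sets_def)
  have h_arc: "h x \<le> h y + 1" if "(x, y) \<in> parcs (half_graph k d)" for x y
    using that h_elem by (auto simp: half_graph_def half_graph_edges_def h_block) (auto simp: h_point)
  have "ereal (h (point (2 * k + d)) - h (point (2 * k))) \<le> diameter (with_proj (half_graph k d))"
    using h_arc G.wf_digraph_axioms
    by (intro diameter_ge_potential_difference) (auto simp: pverts_half_graph)
  then show ?thesis by (simp add: h_point)
qed

section \<open>Domination in the graph and in its direct square\<close>

text \<open>Two complementary blocks take care of all element points, and path points take care of
  the rest, so the bound does not depend on \<open>k\<close>.\<close>

lemma exists_small_set_dominating_points:
  assumes k: "k > 0"
  shows "\<exists>T \<subseteq> pverts (half_graph k d). card T \<le> d + 4 \<and>
    (\<forall>i\<le>2 * k + d. \<exists>u\<in>T. (point i, u) \<in> parcs (half_graph k d))"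
proof -
  \<comment> \<open>Two blocks and \<open>d + 2\<close> path points. The range starts at
    \<open>2 * k - 1\<close> so that \<open>point (2 * k)\<close> has its predecessor in
    \<open>T\<close>.\<close>
  define T where "T = block ` {{..<k}, {k..<2 * k}} \<union> point ` {2 * k - 1..2 * k + d}"
  have halves: "{..<k} \<in> half_sets k" "{k..<2 * k} \<in> half_sets k"
    by (auto simp: half_sets_def)
  then have sub: "T \<subseteq> pverts (half_graph k d)"
    by (auto simp: T_def pverts_half_graph)
  have "card T \<le> card (block ` {{..<k}, {k..<2 * k}}) + card (point ` {2 * k - 1..2 * k + d})"
    unfolding T_def by (rule card_Un_le)
  also have "\<dots> \<le> card {{..<k}, {k..<2 * k}} + card {2 * k - 1..2 * k + d}"
    by (intro add_mono card_image_le) auto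
  also have "\<dots> \<le> d + 4" using k by (simp add: card_insert_if)
  finally have card: "card T \<le> d + 4" .
  have "\<exists>u\<in>T. (point i, u) \<in> parcs (half_graph k d)" if i: "i \<le> 2 * k + d" for i
  proof (cases "i < 2 * k")
    case True
    then have "i \<in> {..<k} \<or> i \<in> {k..<2 * k}" by auto
    then show ?thesis using halves point_block_arc(1) unfolding T_def by blast
  next
    case False
    then obtain j where j: "i = Suc j" "2 * k \<le> Suc j" using k by (cases i) auto
    then have "(point i, point j) \<in> parcs (half_graph k d)" "point j \<in> T"
      using i path_arc(2)[of k j d] by (auto simp: T_def)
    then show ?thesis by blast
  qed
  with sub card show ?thesis by blast
qed

lemma no_isolated_verts_half_graph:
  assumes "k > 0"
  shows "no_isolated_verts (with_proj (half_graph k d))"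
proof -
  have "\<exists>u\<in>pverts (half_graph k d). (v, u) \<in> parcs (half_graph k d)"
    if v: "v \<in> pverts (half_graph k d)" for v
  proof -
    from v consider "v \<in> block ` half_sets k" | "v \<in> point ` {..2 * k + d}"
      unfolding pverts_half_graph by blast
    then show ?thesis
    proof cases
      case 1
      then obtain A where A: "A \<in> half_sets k" "v = block A" by blast
      then have "A \<noteq> {}" using assms by (auto simp: half_sets_def)
      then obtain i where i: "i \<in> A" by blast
      then have "point i \<in> pverts (half_graph k d)"
        using A by (auto simp: half_sets_def pverts_half_graph)
      moreover have "(v, point i) \<in> parcs (half_graph k d)"
        using A i point_block_arc(2) by blast
      ultimately show ?thesis by blast
    next
      case 2
      then show ?thesis using exists_small_set_dominating_points[OF assms, of d] by blast
    qed
  qed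
  then show ?thesis by (simp add: no_isolated_verts_def)
qed

text \<open>All neighbours of a block are its elements, so the points in a paired dominating set
  form a transversal of the half-sets.\<close>

lemma paired_domination_number_half_graph_ge:
  assumes "k > 0"
  shows "k < paired_domination_number (with_proj (half_graph k d))"
proof -
  interpret G: pair_graph "half_graph k d" by (rule pair_graph_half_graph)
  have "Suc k \<le> card D" if D: "paired_dominating_set (with_proj (half_graph k d)) D" for D
  proof -
    have "D \<subseteq> pverts (half_graph k d)"
      using D unfolding paired_dominating_set_def dominating_set_def by auto
    then have finD: "finite D" using G.pair_finite_verts by (rule finite_subset)
    let ?I = "{i. point i \<in> D}"
    have inj: "inj_on point ?I" by (auto intro: inj_onI)
    have img: "point ` ?I \<subseteq> D" by auto
    have "finite ?I" using inj img finD finite_imageD finite_subset by metis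
    moreover have "A \<inter> ?I \<noteq> {}" if A: "A \<in> half_sets k" for A
    proof -
      have "block A \<in> pverts (half_graph k d)" using A by (simp add: pverts_half_graph)
      then obtain u where "u \<in> D" "(block A, u) \<in> parcs (half_graph k d)"
        using paired_dominating_set_neighbour[OF D G.pair_sym_arcs, of "block A"] by auto
      then show ?thesis using arc_from_block A by blast
    qed
    ultimately have "k < card ?I" by (rule transversal_of_half_sets_card)
    also have "card ?I \<le> card D" using inj img finD by (rule card_inj_on_le)
    finally show ?thesis by simp
  qed
  then have "Suc k \<le> paired_domination_number (with_proj (half_graph k d))"
    using no_isolated_verts_half_graph[OF assms] G.pair_finite_verts G.wf_digraph_axioms
    by (intro paired_domination_number_geI) auto
  then show ?thesis by simp
qed

text \<open>For fixed \<open>d\<close> the bound is linear in \<open>k\<close>. Dominating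
  coordinatewise would use up to \<open>4 * k * k\<close> pairs of points for the pairs of blocks;
  the small transversal replaces them.\<close>

lemma paired_domination_number_half_graph_product_le:
  assumes k: "k > 0"
  shows "paired_domination_number (with_proj (direct_product (half_graph k d) (half_graph k d)))
    \<le> 2 * ((d + 4) * (d + 4) + 4 * k * (d + 4) + 10 * k)"
proof -
  let ?G = "half_graph k d" and ?GG = "direct_product (half_graph k d) (half_graph k d)"
  interpret GG: pair_graph ?GG
    by (intro pair_graph_direct_product pair_graph_half_graph)
  obtain T where T: "T \<subseteq> pverts ?G" "card T \<le> d + 4"
    and Tdom: "\<forall>i\<le>2 * k + d. \<exists>u\<in>T. (point i, u) \<in> parcs ?G"
    using exists_small_set_dominating_points[OF k, of d] by (elim exE conjE) (rule that)
  have finT: "finite T"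
    using T(1) finite_half_sets by (auto simp: pverts_half_graph intro: finite_subset)
  define S where "S = point ` {..<2 * k}"
  have S: "S \<subseteq> pverts ?G" "card S \<le> 2 * k" "finite S"
    using card_image_le[of "{..<2 * k}" point] by (auto simp: S_def pverts_half_graph)
  have Sdom: "\<exists>u\<in>S. (block A, u) \<in> parcs ?G" if A: "A \<in> half_sets k" for A
  proof -
    have "A \<noteq> {}" "A \<subseteq> {..<2 * k}" using A k by (auto simp: half_sets_def)
    then show ?thesis using point_block_arc(2)[OF A] unfolding S_def by blast
  qed
  obtain E where E: "E \<subseteq> {..<2 * k} \<times> {..<2 * k}" "card E \<le> 10 * k"
    and Edom: "\<forall>A\<in>half_sets k. \<forall>B\<in>half_sets k. E \<inter> A \<times> B \<noteq> {}"
    using exists_small_transversal_of_half_set_products[OF k] by (elim exE conjE) (rule that)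
  have finE: "finite E" using E(1) finite_subset by blast
  define Q where "Q = map_prod point point ` E"
  have Q: "card Q \<le> 10 * k" "finite Q" "Q \<subseteq> S \<times> S"
    using card_image_le[OF finE, of "map_prod point point"] E finE by (auto simp: Q_def S_def)
  \<comment> \<open>\<open>T \<times> T\<close> serves pairs of points, the mixed products serve a
    point paired with a block, and \<open>Q\<close> serves pairs of blocks.\<close>
  let ?D = "T \<times> T \<union> (T \<times> S \<union> S \<times> T) \<union> Q"
  have "\<exists>q\<in>?D. (p, q) \<in> parcs ?GG" if p: "p \<in> pverts ?GG" for p
  proof -
    have arcI: "(p, (a, b)) \<in> parcs ?GG"
      if "(fst p, a) \<in> parcs ?G" "(snd p, b) \<in> parcs ?G" for a b
      using that by (cases p) (auto simp: direct_product_def)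
    have point_or_block: "(\<exists>u\<in>T. (v, u) \<in> parcs ?G) \<or>
        (\<exists>A\<in>half_sets k. v = block A) \<and> (\<exists>u\<in>S. (v, u) \<in> parcs ?G)"
      if "v \<in> pverts ?G" for v
      using that Tdom Sdom unfolding pverts_half_graph by blast
    have "fst p \<in> pverts ?G" "snd p \<in> pverts ?G"
      using p by (auto simp: direct_product_def)
    \<comment> \<open>The last two cases overlap in the pairs of points; \<open>S \<union> T\<close>
      leaves the kind of the other coordinate open.\<close>
    from this[THEN point_or_block] consider
        (blocks) A B where "A \<in> half_sets k" "B \<in> half_sets k" "fst p = block A" "snd p = block B"
      | (fst_point) a b where "a \<in> T" "b \<in> S \<union> T" "(fst p, a) \<in> parcs ?G" "(snd p, b) \<in> parcs ?G"
      | (snd_point) a b where "a \<in> S \<union> T" "b \<in> T" "(fst p, a) \<in> parcs ?G" "(snd p, b) \<in> parcs ?G"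
      by blast
    then show ?thesis
    proof cases
      case blocks
      obtain i j where "(i, j) \<in> E" "i \<in> A" "j \<in> B" using Edom blocks(1,2) by blast
      then have "(p, (point i, point j)) \<in> parcs ?GG"
        using blocks by (intro arcI) (simp_all add: point_block_arc)
      moreover have "(point i, point j) \<in> Q"
        using \<open>(i, j) \<in> E\<close> by (force simp: Q_def)
      ultimately show ?thesis by blast
    next
      case fst_point
      then show ?thesis using arcI by blast
    next
      case snd_point
      then show ?thesis using arcI by blast
    qed
  qed
  moreover have "?D \<subseteq> pverts ?GG"
    using T S Q by (auto simp: direct_product_def)
  ultimately have "dominating_set (with_proj ?GG) ?D"
    by (auto simp: dominating_set_def)
  then have "paired_domination_number (with_proj ?GG) \<le> 2 * card ?D"
    using GG.pair_finite_verts GG.wf_digraph_axioms no_isolated_verts_half_graph[OF k]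
    by (intro paired_domination_number_le no_isolated_verts_direct_product) auto
  also have "card ?D \<le> card (T \<times> T) + (card (T \<times> S) + card (S \<times> T)) + card Q"
    by (intro card_Un_le[THEN order_trans] add_mono order_refl card_Un_le)
  also have "\<dots> \<le> (d + 4) * (d + 4) + ((d + 4) * (2 * k) + (2 * k) * (d + 4)) + 10 * k"
    unfolding card_cartesian_product using T S Q by (intro add_mono mult_mono) auto
  finally show ?thesis by (simp add: algebra_simps)
qed

theorem theorem1:
  fixes c :: real and d :: nat
  assumes "c > 0" and "d > 0"
  shows "\<exists>G :: nat pair_pre_digraph.
    pair_graph G \<and> Digraph_Component.connected (with_proj G) \<and> no_isolated_verts (with_proj G) \<and>
    diameter (with_proj G) \<ge> ereal (real d) \<and>
    real (paired_domination_number (with_proj (direct_product G G)))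
      < c * (real (paired_domination_number (with_proj G)))\<^sup>2"
proof -
  \<comment> \<open>\<open>C * k\<close> bounds the number of the product for
    \<open>k \<ge> 1\<close>, while the square for the factor exceeds \<open>k * k\<close>; hence
    \<open>C < c * k\<close> suffices.\<close>
  define C where "C = 2 * ((d + 4) * (d + 4) + 4 * (d + 4) + 10)"
  obtain m :: nat where m: "real C / c < real m" using reals_Archimedean2 by blast
  \<comment> \<open>The lower limit 2 is for connectedness.\<close>
  define k where "k = max 2 m"
  have k: "2 \<le> k" "k > 0" by (auto simp: k_def)
  have "real C / c < real k" using m by (simp add: k_def)
  then have Ck: "real C < c * real k" using assms(1) by (simp add: field_simps)
  let ?G = "half_graph k d"
  have "(d + 4) * (d + 4) * 1 \<le> (d + 4) * (d + 4) * k" using k by (intro mult_left_mono) auto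
  then have "2 * ((d + 4) * (d + 4) + 4 * k * (d + 4) + 10 * k) \<le> C * k"
    unfolding C_def by (simp add: algebra_simps)
  then have "paired_domination_number (with_proj (direct_product ?G ?G)) \<le> C * k"
    using paired_domination_number_half_graph_product_le[OF k(2), of d] by linarith
  then have "real (paired_domination_number (with_proj (direct_product ?G ?G))) \<le> real C * real k"
    by (metis of_nat_le_iff of_nat_mult)
  also have "\<dots> < c * real k * real k"
    using Ck k by (intro mult_strict_right_mono) auto
  also have "\<dots> = c * (real k)\<^sup>2" by (simp add: power2_eq_square)
  also have "\<dots> \<le> c * (real (paired_domination_number (with_proj ?G)))\<^sup>2"
    using paired_domination_number_half_graph_ge[OF k(2), of d] assms(1)
    by (intro mult_left_mono power_mono) auto
  finally show ?thesis
    using pair_graph_half_graph connected_half_graph[OF k(1)] diameter_half_graph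
      no_isolated_verts_half_graph[OF k(2)] by blast
qed

end
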